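(* For every integer $n\ge 2$, $R_{\pi}(F_n,K_3)=2n$.
   Context: All graphs are finite and simple. For graphs $F,G,H$, write $F\rightarrow(G,H)$ if every red-blue coloring of the edges of $F$ contains a red copy of $G$ or a blue copy of $H$. The Ramsey number $R(G,H)$ is the smallest $r$ with $K_r\rightarrow(G,H)$. $K_r\setminus P_k$ denotes $K_r$ with the edges of a path on $k$ vertices ($k\le r$) deleted. The path-critical Ramsey number is $R_{\pi}(G,H)=\max\{k: K_r\setminus P_k\rightarrow(G,H)\}$ where $r=R(G,H)$. $F_n=K_1+nK_2$ is the fan graph: a vertex joined to all vertices of $n$ vertex-disjoint edges (join of $K_1$ with $nK_2$). *)

theory Defs
  imports "HOL-Library.Ramsey"
begin

text \<open>A graph is a pair of a vertex set and a set of edges, an edge being a two-element set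
  of vertices.\<close>

type_synonym 'a graph = "'a set \<times> 'a set set"

abbreviation verts :: "'a graph \<Rightarrow> 'a set" where
  "verts \<equiv> fst"

abbreviation edges :: "'a graph \<Rightarrow> 'a set set" where
  "edges \<equiv> snd"

definition simple_graph :: "'a graph \<Rightarrow> bool" where
  "simple_graph G \<longleftrightarrow> finite (verts G) \<and> edges G \<subseteq> [verts G]\<^bsup>2\<^esup>"

text \<open>Copies are not required to be induced.\<close>

definition contains_copy :: "'a graph \<Rightarrow> 'b graph \<Rightarrow> bool" where
  "contains_copy F G \<longleftrightarrow>
     (\<exists>f. inj_on f (verts G) \<and> f ` verts G \<subseteq> verts F \<and> (\<forall>e\<in>edges G. f ` e \<in> edges F))"

datatype colour = Red | Blue

definition colour_class :: "'a graph \<Rightarrow> ('a set \<Rightarrow> colour) \<Rightarrow> colour \<Rightarrow> 'a graph" where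
  "colour_class F c x = (verts F, {e \<in> edges F. c e = x})"

definition arrows :: "'a graph \<Rightarrow> 'b graph \<Rightarrow> 'c graph \<Rightarrow> bool" where
  "arrows F G H \<longleftrightarrow>
     (\<forall>c. contains_copy (colour_class F c Red) G \<or> contains_copy (colour_class F c Blue) H)"

definition complete_graph :: "nat \<Rightarrow> nat graph" where
  "complete_graph r = ({..<r}, [{..<r}]\<^bsup>2\<^esup>)"

definition path_graph :: "nat \<Rightarrow> nat graph" where
  "path_graph k = ({..<k}, {{i, Suc i} | i. Suc i < k})"

text \<open>For \<open>k \<le> r\<close>, the path on the vertices \<open>0, \<dots>, k - 1\<close> is a subgraph of
  \<open>complete_graph r\<close>; by symmetry, deleting the edges of any other path on \<open>k\<close> vertices gives
  an isomorphic graph.\<close>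

definition complete_minus_path :: "nat \<Rightarrow> nat \<Rightarrow> nat graph" where
  "complete_minus_path r k =
     (verts (complete_graph r), edges (complete_graph r) - edges (path_graph k))"

definition ramsey_number :: "'a graph \<Rightarrow> 'b graph \<Rightarrow> nat" where
  "ramsey_number G H = (LEAST r. arrows (complete_graph r) G H)"

definition path_critical_ramsey_number :: "'a graph \<Rightarrow> 'b graph \<Rightarrow> nat" where
  "path_critical_ramsey_number G H =
     (let r = ramsey_number G H
      in Max {k. 1 \<le> k \<and> k \<le> r \<and> arrows (complete_minus_path r k) G H})"

definition graph_join :: "'a graph \<Rightarrow> 'b graph \<Rightarrow> ('a + 'b) graph" where
  "graph_join G H =
     (verts G <+> verts H,
      (`) Inl ` edges G \<union> (`) Inr ` edges H \<union> {{Inl u, Inr v} | u v. u \<in> verts G \<and> v \<in> verts H})"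

definition disjoint_copies :: "nat \<Rightarrow> 'a graph \<Rightarrow> (nat \<times> 'a) graph" where
  "disjoint_copies n G = ({..<n} \<times> verts G, {Pair i ` e | i e. i < n \<and> e \<in> edges G})"

definition fan_graph :: "nat \<Rightarrow> (nat + nat \<times> nat) graph" where
  "fan_graph n = graph_join (complete_graph 1) (disjoint_copies n (complete_graph 2))"

lemma simple_complete_graph: "simple_graph (complete_graph r)"
  by (simp add: simple_graph_def complete_graph_def)

lemma simple_path_graph: "simple_graph (path_graph k)"
  by (auto simp: simple_graph_def path_graph_def)

lemma path_graph_subgraph: "k \<le> r \<Longrightarrow> edges (path_graph k) \<subseteq> edges (complete_graph r)"
  by (auto simp: complete_graph_def path_graph_def)

lemma simple_complete_minus_path: "simple_graph (complete_minus_path r k)"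
  by (auto simp: simple_graph_def complete_minus_path_def complete_graph_def)

lemma image_in_nsets: "e \<in> [A]\<^bsup>k\<^esup> \<Longrightarrow> inj_on f A \<Longrightarrow> f ` A \<subseteq> B \<Longrightarrow> f ` e \<in> [B]\<^bsup>k\<^esup>"
  by (auto simp: nsets_def card_image inj_on_subset)

lemma simple_disjoint_copies: "simple_graph G \<Longrightarrow> simple_graph (disjoint_copies n G)"
  by (auto simp: simple_graph_def disjoint_copies_def inj_on_def intro!: image_in_nsets)

lemma simple_graph_join: "simple_graph G \<Longrightarrow> simple_graph H \<Longrightarrow> simple_graph (graph_join G H)"
  by (auto simp: simple_graph_def graph_join_def intro!: image_in_nsets)

lemma simple_fan_graph: "simple_graph (fan_graph n)"
  by (simp add: fan_graph_def simple_graph_join simple_disjoint_copies simple_complete_graph)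

end

theory Submission
  imports Defs
begin

text \<open>Colouring two classes of size \<open>2 n\<close> red inside and blue across shows that the
  Ramsey number exceeds \<open>4 n\<close>. If a path on more than \<open>2 n\<close> vertices is deleted
  from \<open>K\<^bsub>4n+1\<^esub>\<close>, one class may have size \<open>2 n + 1\<close>: after placing
  the first \<open>2 n + 1\<close> path vertices in it, no vertex has \<open>2 n\<close> red neighbours.

  Conversely, let \<open>K\<^bsub>4n+1\<^esub>\<close> minus a path on \<open>2 n\<close> vertices be
  coloured with neither a red fan nor a blue triangle. A set without blue edges has at most \<open>2
  n\<close> vertices, as otherwise one of them off the path is the centre of a red fan; thus blue degrees
  are at most \<open>2 n\<close>. Red degrees are at most \<open>2 n + 1\<close>, since \<open>2 n +
  2\<close> vertices always carry a red matching of size \<open>n\<close>. The \<open>2 n + 1\<close>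
  vertices off the path span a blue edge \<open>v w\<close>, and at most three vertices are blue neighbours
  of neither end. These would have to be blue to almost all of one or both blue neighbourhoods, because a
  red matching in the red neighbourhood of \<open>w\<close> is a fan; for \<open>n \<ge> 3\<close> this
  makes some blue degree exceed \<open>2 n\<close> or produces a blue triangle or another fan.\<close>

section \<open>Matchings, fans and lower bounds\<close>

text \<open>Taking out one edge at a time lets every induction choose a single edge. Vertices
  outside the matching may remain in \<open>S\<close>.\<close>

primrec has_matching :: "('a \<Rightarrow> 'a \<Rightarrow> bool) \<Rightarrow> nat \<Rightarrow> 'a set \<Rightarrow> bool" where
  "has_matching E 0 S \<longleftrightarrow> True"
| "has_matching E (Suc k) S \<longleftrightarrow> (\<exists>x\<in>S. \<exists>y\<in>S. x \<noteq> y \<and> E x y \<and> has_matching E k (S - {x, y}))"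

lemma has_matching_mono: "has_matching E k S \<Longrightarrow> S \<subseteq> T \<Longrightarrow> has_matching E k T"
proof (induction k arbitrary: S T)
  case (Suc k)
  then obtain x y where xy: "x \<in> S" "y \<in> S" "x \<noteq> y" "E x y" and m: "has_matching E k (S - {x, y})"
    by auto
  have "has_matching E k (T - {x, y})"
    using Suc.IH[OF m, of "T - {x, y}"] Suc.prems(2) by blast
  with xy Suc.prems(2) show ?case by auto
qed simp

lemma has_matching_insert_edge:
  assumes "has_matching E k S" "x \<notin> S" "y \<notin> S" "x \<noteq> y" "E x y"
  shows "has_matching E (Suc k) (insert x (insert y S))"
proof -
  have "insert x (insert y S) - {x, y} = S"
    using assms by auto
  then have "has_matching E k (insert x (insert y S) - {x, y})"
    using assms by simp
  then show ?thesis
    using assms by auto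
qed

text \<open>The index set is the vertex set of \<open>disjoint_copies k (complete_graph 2)\<close>,
  so the map can serve as the rim of a fan.\<close>

lemma has_matching_embedding:
  "has_matching E k S \<Longrightarrow>
    \<exists>f :: nat \<times> nat \<Rightarrow> 'a. inj_on f ({..<k} \<times> {..<2}) \<and> f ` ({..<k} \<times> {..<2}) \<subseteq> S \<and>
      (\<forall>i<k. E (f (i, 0)) (f (i, 1)))"
proof (induction k arbitrary: S)
  case (Suc k)
  then obtain x y where xy: "x \<in> S" "y \<in> S" "x \<noteq> y" "E x y" and m: "has_matching E k (S - {x, y})"
    by auto
  obtain f :: "nat \<times> nat \<Rightarrow> 'a" where f: "inj_on f ({..<k} \<times> {..<2})"
      "f ` ({..<k} \<times> {..<2}) \<subseteq> S - {x, y}" "\<forall>i<k. E (f (i, 0)) (f (i, 1))"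
    using Suc.IH[OF m] by blast
  define g where "g = f((k, 0) := x, (k, 1) := y)"
  have dom: "{..<Suc k} \<times> {..<2} = insert (k, 0) (insert (k, 1) ({..<k} \<times> {..<2::nat}))"
    by (auto simp: less_Suc_eq)
  have same: "g p = f p" if "p \<in> {..<k} \<times> {..<2}" for p
    using that by (auto simp: g_def)
  then have inj: "inj_on g ({..<k} \<times> {..<2})" and img: "g ` ({..<k} \<times> {..<2}) = f ` ({..<k} \<times> {..<2})"
    using f(1) by (auto simp: inj_on_def)
  have "inj_on g ({..<Suc k} \<times> {..<2})"
    unfolding dom inj_on_insert using inj img f(2) xy(3) by (auto simp: g_def)
  moreover have "g ` ({..<Suc k} \<times> {..<2}) \<subseteq> S"
    unfolding dom image_insert img using f(2) xy by (auto simp: g_def)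
  moreover have "\<forall>i<Suc k. E (g (i, 0)) (g (i, 1))"
    using f(3) xy(4) by (auto simp: g_def less_Suc_eq)
  ultimately show ?case by blast
qed simp

lemma complete_graph_2: "complete_graph 2 = ({..<2}, {{0, 1}})"
proof -
  have "{..<2::nat} = {0, 1}" by auto
  then show ?thesis by (auto simp: complete_graph_def nsets_2_eq)
qed

lemma contains_copy_fan:
  assumes "x \<in> verts F" "edges F \<subseteq> [verts F]\<^bsup>2\<^esup>"
    and m: "has_matching (\<lambda>y z. {y, z} \<in> edges F) n {y. {x, y} \<in> edges F}"
  shows "contains_copy F (fan_graph n)"
proof -
  obtain f :: "nat \<times> nat \<Rightarrow> 'a" where f: "inj_on f ({..<n} \<times> {..<2})"
      "f ` ({..<n} \<times> {..<2}) \<subseteq> {y. {x, y} \<in> edges F}" "\<forall>i<n. {f (i, 0), f (i, 1)} \<in> edges F"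
    using has_matching_embedding[OF m] by blast
  define g where "g = case_sum (\<lambda>_::nat. x) f"
  have nbr: "f p \<noteq> x \<and> f p \<in> verts F \<and> {x, f p} \<in> edges F" if "p \<in> {..<n} \<times> {..<2}" for p
  proof -
    have "{x, f p} \<in> edges F"
      using f(2) that by blast
    moreover from this have "{x, f p} \<in> [verts F]\<^bsup>2\<^esup>"
      using assms(2) by blast
    ultimately show ?thesis by auto
  qed
  have V: "verts (fan_graph n) = {..<1} <+> ({..<n} \<times> {..<2})"
    by (simp add: fan_graph_def graph_join_def disjoint_copies_def complete_graph_def)
  have "inj_on g (verts (fan_graph n))"
    unfolding V using f(1) nbr by (force simp: g_def inj_on_def Plus_def)
  moreover have "g ` verts (fan_graph n) \<subseteq> verts F"
    unfolding V using assms(1) nbr by (force simp: g_def Plus_def)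
  moreover have "g ` e \<in> edges F" if e: "e \<in> edges (fan_graph n)" for e
  proof -
    have "[{..<Suc 0}]\<^bsup>2\<^esup> = {}"
      by (auto simp: nsets_2_eq)
    then consider (rim) i where "i < n" "e = {Inr (i, 0), Inr (i, 1)}"
      | (spoke) p where "p \<in> {..<n} \<times> {..<2}" "e = {Inl 0, Inr p}"
      using e unfolding fan_graph_def complete_graph_2
      by (auto simp: graph_join_def disjoint_copies_def complete_graph_def)
    then show ?thesis
      by cases (use f(3) nbr in \<open>auto simp: g_def\<close>)
  qed
  ultimately show ?thesis
    unfolding contains_copy_def by blast
qed

section \<open>Lower bounds from two-part colourings\<close>

text \<open>Colour red inside the two parts given by \<open>p\<close> and blue across. Blue is then
  bipartite, hence triangle-free, and the centre of a red fan would need \<open>2 * n\<close> red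
  neighbours.\<close>

lemma not_arrows_if_bipartition:
  fixes F :: "'a graph" and p :: "'a \<Rightarrow> bool"
  assumes "simple_graph F"
    and few: "\<And>x. x \<in> verts F \<Longrightarrow> card {y. {x, y} \<in> edges F \<and> p y = p x} < 2 * n"
  shows "\<not> arrows F (fan_graph n) (complete_graph 3)"
proof -
  define c where "c e = (if \<exists>b. \<forall>x\<in>e. p x = b then Red else Blue)" for e
  have pair: "c {x, y} = Red \<longleftrightarrow> p y = p x" for x y
    by (auto simp: c_def)
  have fin: "finite {y. {x, y} \<in> edges F \<and> p y = p x}" for x
  proof (rule finite_subset)
    show "{y. {x, y} \<in> edges F \<and> p y = p x} \<subseteq> verts F"
      using assms(1) unfolding simple_graph_def by (auto dest!: subsetD)
    show "finite (verts F)"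
      using assms(1) by (simp add: simple_graph_def)
  qed
  have "\<not> contains_copy (colour_class F c Red) (fan_graph n)"
  proof
    assume "contains_copy (colour_class F c Red) (fan_graph n)"
    then obtain f where f: "inj_on f (verts (fan_graph n))" "f ` verts (fan_graph n) \<subseteq> verts F"
        "\<forall>e\<in>edges (fan_graph n). f ` e \<in> edges F \<and> c (f ` e) = Red"
      unfolding contains_copy_def colour_class_def by auto
    let ?I = "{..<n} \<times> {..<2::nat}"
    have V: "verts (fan_graph n) = {..<1} <+> ?I"
      by (simp add: fan_graph_def graph_join_def disjoint_copies_def complete_graph_def)
    have "{Inl 0, Inr q} \<in> edges (fan_graph n)" if "q \<in> ?I" for q
      using that by (auto simp: fan_graph_def graph_join_def disjoint_copies_def complete_graph_def)
    then have "f ` Inr ` ?I \<subseteq> {y. {f (Inl 0), y} \<in> edges F \<and> p y = p (f (Inl 0))}"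
      using f(3) by (force simp flip: pair)
    moreover have "card (f ` Inr ` ?I) = 2 * n"
    proof -
      have "inj_on f (Inr ` ?I)"
        by (rule inj_on_subset[OF f(1)]) (auto simp: V)
      then show ?thesis
        by (simp add: card_image)
    qed
    ultimately have "2 * n \<le> card {y. {f (Inl 0), y} \<in> edges F \<and> p y = p (f (Inl 0))}"
      using card_mono[OF fin, of "f ` Inr ` ?I" "f (Inl 0)"] by simp
    moreover have "f (Inl 0) \<in> verts F"
      using f(2) by (auto simp: V)
    ultimately show False
      using few[of "f (Inl 0)"] by simp
  qed
  moreover have "\<not> contains_copy (colour_class F c Blue) (complete_graph 3)"
  proof
    assume "contains_copy (colour_class F c Blue) (complete_graph 3)"
    then obtain f :: "nat \<Rightarrow> 'a" where f: "\<forall>e\<in>[{..<3}]\<^bsup>2\<^esup>. c (f ` e) = Blue"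
      unfolding contains_copy_def colour_class_def complete_graph_def by auto
    have "p (f j) \<noteq> p (f i)" if "i < 3" "j < 3" "i \<noteq> j" for i j
    proof -
      have "{i, j} \<in> [{..<3}]\<^bsup>2\<^esup>"
        using that by simp
      then have "c {f i, f j} = Blue"
        using f by fastforce
      then show ?thesis
        using pair by (metis colour.distinct(1))
    qed
    from this[of 0 1] this[of 0 2] this[of 1 2] show False
      by auto
  qed
  ultimately show ?thesis
    unfolding arrows_def by blast
qed

lemma arrows_mono:
  assumes "arrows F G H" "verts F \<subseteq> verts F'" "edges F \<subseteq> edges F'"
  shows "arrows F' G H"
proof -
  have "contains_copy (colour_class F' c x) K" if "contains_copy (colour_class F c x) K"
    for c x and K :: "'d graph"
    using that assms(2,3) unfolding contains_copy_def colour_class_def by fastforce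
  then show ?thesis
    using assms(1) unfolding arrows_def contains_copy_def colour_class_def
    by (smt (verit, best) assms(2,3) fst_conv mem_Collect_eq snd_conv subset_iff)
qed

lemma not_arrows_complete_graph:
  assumes "r \<le> 4 * n" "n \<ge> 1"
  shows "\<not> arrows (complete_graph r) (fan_graph n) (complete_graph 3)"
proof (rule not_arrows_if_bipartition[where p = "\<lambda>x. x < 2 * n"])
  fix x assume "x \<in> verts (complete_graph r)"
  then have x: "x < r"
    by (simp add: complete_graph_def)
  let ?S = "{y. {x, y} \<in> edges (complete_graph r) \<and> (y < 2 * n) = (x < 2 * n)}"
  let ?side = "if x < 2 * n then {..<2 * n} else {2 * n..<4 * n}"
  have "?S \<subseteq> ?side - {x}"
    using assms by (auto simp: complete_graph_def)
  then have "card ?S \<le> card (?side - {x})"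
    by (intro card_mono) auto
  also have "\<dots> < card ?side"
    using x assms by (intro card_Diff1_less) auto
  also have "card ?side = 2 * n"
    by simp
  finally show "card ?S < 2 * n" .
qed (rule simple_complete_graph)

lemma not_arrows_complete_minus_path:
  assumes "2 * n < k" "n \<ge> 1"
  shows "\<not> arrows (complete_minus_path (4 * n + 1) k) (fan_graph n) (complete_graph 3)"
proof (rule not_arrows_if_bipartition[where p = "\<lambda>x. x \<le> 2 * n"])
  fix x assume "x \<in> verts (complete_minus_path (4 * n + 1) k)"
  then have x: "x < 4 * n + 1"
    by (simp add: complete_minus_path_def complete_graph_def)
  let ?S = "{y. {x, y} \<in> edges (complete_minus_path (4 * n + 1) k) \<and> (y \<le> 2 * n) = (x \<le> 2 * n)}"
  show "card ?S < 2 * n"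
  proof (cases "x \<le> 2 * n")
    case True
    \<comment> \<open>A path neighbour of \<open>x\<close> that stays in the part of
      \<open>x\<close>; the vertex 0 has no predecessor and takes 1. The edge is deleted because
      \<open>2 * n < k\<close>.\<close>
    define x' where "x' = (if x = 0 then 1 else x - 1)"
    have "{x, x'} \<in> edges (path_graph k)"
    proof (cases "x = 0")
      case True
      then show ?thesis
        using assms by (auto simp: path_graph_def x'_def)
    next
      case False
      then have "{x, x'} = {x - 1, Suc (x - 1)} \<and> Suc (x - 1) < k"
        using assms \<open>x \<le> 2 * n\<close> by (auto simp: x'_def)
      then show ?thesis
        unfolding path_graph_def by auto
    qed
    then have "?S \<subseteq> {..2 * n} - {x, x'}"
      using True by (auto simp: complete_minus_path_def complete_graph_def)
    then have "card ?S \<le> card ({..2 * n} - {x, x'})"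
      by (intro card_mono) auto
    also have "\<dots> = 2 * n + 1 - 2"
    proof -
      have "x \<noteq> x'" "x' \<le> 2 * n"
        using True assms by (auto simp: x'_def)
      then show ?thesis
        using True by (subst card_Diff_subset) auto
    qed
    finally show ?thesis
      using assms by simp
  next
    case False
    have "?S \<subseteq> {2 * n + 1..<4 * n + 1} - {x}"
      using False by (auto simp: complete_minus_path_def complete_graph_def)
    then have "card ?S \<le> card ({2 * n + 1..<4 * n + 1} - {x})"
      by (intro card_mono) auto
    then show ?thesis
      using False x assms by auto
  qed
qed (rule simple_complete_minus_path)

text \<open>These congruence rules make the simplifier expand bounded quantifiers from the outside in, so that
  false guards cut off the expansion early.\<close>

lemma Ball_weak_cong: "X = Y \<Longrightarrow> Ball X P = Ball Y P"
  by simp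

lemma imp_weak_cong: "P = P' \<Longrightarrow> (P \<longrightarrow> Q) = (P' \<longrightarrow> Q)"
  by simp

section \<open>Colourings without a red fan and a blue triangle\<close>

lemma has_matching_1: "x \<in> S \<Longrightarrow> y \<in> S \<Longrightarrow> x \<noteq> y \<Longrightarrow> E x y \<Longrightarrow> has_matching E 1 S"
  by auto

lemma has_matching_2:
  assumes "{x, y, z, w} \<subseteq> S" "distinct [x, y, z, w]" "E x y" "E z w"
  shows "has_matching E 2 S"
proof -
  have "has_matching E 1 (S - {x, y})"
    using assms by (intro has_matching_1[of z _ w]) auto
  then show ?thesis
    using assms unfolding numeral_2_eq_2 by auto
qed

lemma strict_sorted_enumeration:
  assumes "finite (S :: nat set)" "m \<le> card S"
  obtains f :: "nat \<Rightarrow> nat" where "\<And>i. i < m \<Longrightarrow> f i \<in> S" "\<And>i j. i < j \<Longrightarrow> j < m \<Longrightarrow> f i < f j"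
proof
  let ?xs = "sorted_list_of_set S"
  show "?xs ! i \<in> S" if "i < m" for i
    using that assms nth_mem[of i ?xs] by simp
  show "?xs ! i < ?xs ! j" if "i < j" "j < m" for i j
    using that assms sorted_wrt_nth_less[OF strict_sorted_list_of_set[of S], of i j] by simp
qed

text \<open>\<open>R\<close> and \<open>B\<close> are the red and the blue adjacency of a counterexample colouring; the pairs
  covered by neither (called \<open>M\<close> below) are edges of the deleted path \<open>0, \<dots>, 2 n - 1\<close>. Hence a
  vertex \<open>q\<close> with \<open>2 * n \<le> q\<close> is not incident with any missing pair.\<close>

locale fan_free_colouring =
  fixes n :: nat and R B :: "nat \<Rightarrow> nat \<Rightarrow> bool"
  assumes n_ge_2: "n \<ge> 2"
    and R_dom: "R x y \<Longrightarrow> x < 4 * n + 1 \<and> y < 4 * n + 1"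
    and B_dom: "B x y \<Longrightarrow> x < 4 * n + 1 \<and> y < 4 * n + 1"
    and R_sym: "R x y \<Longrightarrow> R y x"
    and B_sym: "B x y \<Longrightarrow> B y x"
    and R_irrefl: "\<not> R x x"
    and B_irrefl: "\<not> B x x"
    and not_R_and_B: "R x y \<Longrightarrow> \<not> B x y"
    and total: "x < 4 * n + 1 \<Longrightarrow> y < 4 * n + 1 \<Longrightarrow> x \<noteq> y \<Longrightarrow>
      R x y \<or> B x y \<or> ((y = Suc x \<or> x = Suc y) \<and> x < 2 * n \<and> y < 2 * n)"
    and no_blue_triangle: "B x y \<Longrightarrow> B y z \<Longrightarrow> \<not> B x z"
    and no_red_fan: "\<not> has_matching R n {y. R x y}"
begin

definition V :: "nat set" where "V = {..<4 * n + 1}"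

text \<open>Only the position on the path is recorded; by the assumptions alone such a pair may
  still be red or blue.\<close>

definition M :: "nat \<Rightarrow> nat \<Rightarrow> bool" where
  "M x y \<longleftrightarrow> (y = Suc x \<or> x = Suc y) \<and> x < 2 * n \<and> y < 2 * n"

text \<open>Missing pairs are allowed, so such a set is a red clique only up to edges of the
  path.\<close>

definition blue_free :: "nat set \<Rightarrow> bool" where
  "blue_free S \<longleftrightarrow> S \<subseteq> V \<and> (\<forall>x\<in>S. \<forall>y\<in>S. \<not> B x y)"

lemma finite_V: "finite V" and card_V: "card V = 4 * n + 1"
  by (simp_all add: V_def)

lemma finite_subset_V: "S \<subseteq> V \<Longrightarrow> finite S"
  using finite_V finite_subset by blast

lemma R_V: "R x y \<Longrightarrow> x \<in> V" "R x y \<Longrightarrow> y \<in> V"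
  and B_V: "B x y \<Longrightarrow> x \<in> V" "B x y \<Longrightarrow> y \<in> V"
  using R_dom B_dom by (auto simp: V_def)

lemma M_sym: "M x y \<Longrightarrow> M y x"
  by (auto simp: M_def)

lemma R_B_M: "x \<in> V \<Longrightarrow> y \<in> V \<Longrightarrow> x \<noteq> y \<Longrightarrow> R x y \<or> B x y \<or> M x y"
  using total by (auto simp: V_def M_def)

lemma R_or_B_off_path: "x \<in> V \<Longrightarrow> y \<in> V \<Longrightarrow> x \<noteq> y \<Longrightarrow> 2 * n \<le> x \<Longrightarrow> R x y \<or> B x y"
  using R_B_M by (fastforce simp: M_def)

lemma M_neighbours: "finite {y. M x y}" "card {y. M x y} \<le> 2"
proof -
  have *: "{y. M x y} \<subseteq> {Suc x, x - 1}"
    by (auto simp: M_def)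
  then show "finite {y. M x y}"
    using finite_subset by blast
  have "card {y. M x y} \<le> card {Suc x, x - 1}"
    using * by (intro card_mono) auto
  then show "card {y. M x y} \<le> 2"
    by (simp add: card_insert_if split: if_splits)
qed

lemma no_fan: "S \<subseteq> {y. R x y} \<Longrightarrow> \<not> has_matching R n S"
  using no_red_fan has_matching_mono by metis

text \<open>Vertices at distance at least 2 are never joined by a missing edge, so every other element of a
  sorted list of vertices behaves as in the complete graph.\<close>

lemma red_edge_in_spread_triple:
  assumes "a \<in> V" "b \<in> V" "c \<in> V" "a + 2 \<le> b" "b + 2 \<le> c"
  shows "R a b \<or> R b c \<or> R a c"
proof (rule ccontr)
  assume "\<not> ?thesis"
  moreover have "\<not> M a b" "\<not> M b c" "\<not> M a c"
    using assms by (auto simp: M_def)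
  ultimately have "B a b" "B b c" "B a c"
    using R_B_M[of a b] R_B_M[of b c] R_B_M[of a c] assms by auto
  then show False
    using no_blue_triangle by blast
qed

lemma red_edge_in_five:
  assumes "S \<subseteq> V" "5 \<le> card S"
  obtains x y where "x \<in> S" "y \<in> S" "x \<noteq> y" "R x y"
proof -
  obtain f :: "nat \<Rightarrow> nat" where f: "\<And>i. i < 5 \<Longrightarrow> f i \<in> S" "\<And>i j. i < j \<Longrightarrow> j < 5 \<Longrightarrow> f i < f j"
    using strict_sorted_enumeration[OF finite_subset_V[OF assms(1)] assms(2)] by blast
  have ord: "f 0 < f 1" "f 1 < f 2" "f 2 < f 3" "f 3 < f 4"
    by (auto intro: f(2))
  have mem: "f 0 \<in> S" "f 2 \<in> S" "f 4 \<in> S"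
    by (auto intro: f(1))
  have "R (f 0) (f 2) \<or> R (f 2) (f 4) \<or> R (f 0) (f 4)"
    by (rule red_edge_in_spread_triple) (use ord mem assms(1) in auto)
  then show thesis
    using that mem R_irrefl by metis
qed

text \<open>Six increasing vertices split by parity of position into two spread triples, each with a
  red edge; larger sets lose one red edge at a time. The induction cannot start at 1: four
  consecutive path vertices whose other pairs are blue span neither a red edge nor a blue
  triangle.\<close>

lemma matching_in_large_set:
  assumes "2 \<le> k" "S \<subseteq> V" "2 * k + 2 \<le> card S"
  shows "has_matching R k S"
  using assms
proof (induction k arbitrary: S rule: nat_induct_at_least)
  case base
  have 6: "6 \<le> card S"
    using base by simp
  obtain f :: "nat \<Rightarrow> nat" where f: "\<And>i. i < 6 \<Longrightarrow> f i \<in> S" "\<And>i j. i < j \<Longrightarrow> j < 6 \<Longrightarrow> f i < f j"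
    using strict_sorted_enumeration[OF finite_subset_V[OF base(1)] 6] by blast
  have ord: "f 0 < f 1" "f 1 < f 2" "f 2 < f 3" "f 3 < f 4" "f 4 < f 5"
    by (auto intro: f(2))
  have mem: "f 0 \<in> S" "f 1 \<in> S" "f 2 \<in> S" "f 3 \<in> S" "f 4 \<in> S" "f 5 \<in> S"
    by (auto intro: f(1))
  have "R (f 0) (f 2) \<or> R (f 2) (f 4) \<or> R (f 0) (f 4)" "R (f 1) (f 3) \<or> R (f 3) (f 5) \<or> R (f 1) (f 5)"
    by (intro red_edge_in_spread_triple; use ord mem base(1) in auto)+
  then obtain x y z w where xy: "x \<in> {f 0, f 2, f 4}" "y \<in> {f 0, f 2, f 4}" "R x y"
      and zw: "z \<in> {f 1, f 3, f 5}" "w \<in> {f 1, f 3, f 5}" "R z w"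
    by blast
  have disj: "{f 0, f 2, f 4} \<inter> {f 1, f 3, f 5} = {}" and sub: "{f 0, f 2, f 4} \<union> {f 1, f 3, f 5} \<subseteq> S"
    using ord mem by auto
  have "{x, y, z, w} \<subseteq> S"
    using xy zw sub by blast
  moreover have "x \<noteq> z" "x \<noteq> w" "y \<noteq> z" "y \<noteq> w"
    using xy zw disj by blast+
  moreover have "x \<noteq> y" "z \<noteq> w"
    using xy(3) zw(3) R_irrefl by blast+
  ultimately show ?case
    using has_matching_2[of x y z w S R] xy(3) zw(3) by simp
next
  case (Suc k)
  obtain x y where xy: "x \<in> S" "y \<in> S" "x \<noteq> y" "R x y"
    using red_edge_in_five[OF Suc.prems(1)] Suc.prems(2) Suc.hyps by auto
  have "has_matching R k (S - {x, y})"
    using Suc.prems xy finite_subset_V[OF Suc.prems(1)] by (intro Suc.IH) auto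
  with xy show ?case by auto
qed

section \<open>Blue-free sets and degree bounds\<close>

lemma blue_free_subset: "blue_free S \<Longrightarrow> T \<subseteq> S \<Longrightarrow> blue_free T"
  by (auto simp: blue_free_def)

lemma blue_free_insert:
  assumes "blue_free S" "z \<in> V" "\<And>x. x \<in> S \<Longrightarrow> \<not> B z x"
  shows "blue_free (insert z S)"
  using assms B_sym B_irrefl unfolding blue_free_def by (metis insert_iff insert_subset)

lemma R_or_M_blue_free: "blue_free S \<Longrightarrow> x \<in> S \<Longrightarrow> y \<in> S \<Longrightarrow> x \<noteq> y \<Longrightarrow> R x y \<or> M x y"
  using R_B_M unfolding blue_free_def by blast

lemma red_edge_blue_free:
  assumes "blue_free S" "3 \<le> card S"
  obtains x y where "x \<in> S" "y \<in> S" "x \<noteq> y" "R x y"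
proof -
  have S: "S \<subseteq> V"
    using assms(1) by (simp add: blue_free_def)
  obtain f :: "nat \<Rightarrow> nat" where f: "\<And>i. i < 3 \<Longrightarrow> f i \<in> S" "\<And>i j. i < j \<Longrightarrow> j < 3 \<Longrightarrow> f i < f j"
    using strict_sorted_enumeration[OF finite_subset_V[OF S] assms(2)] by blast
  have "f 0 < f 1" "f 1 < f 2" and mem: "f 0 \<in> S" "f 2 \<in> S"
    by (auto intro: f)
  then have ne: "f 0 \<noteq> f 2" and "\<not> M (f 0) (f 2)"
    by (auto simp: M_def)
  then have "R (f 0) (f 2)"
    using R_or_M_blue_free[OF assms(1)] mem by blast
  with mem ne show thesis
    using that by blast
qed

text \<open>In four increasing vertices, the first and third and the second and fourth are too far
  apart to be missing pairs, so both pairs are red. For \<open>k = 1\<close> the two vertices could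
  form a missing pair.\<close>

lemma blue_free_matching:
  assumes "2 \<le> k" "blue_free S" "2 * k \<le> card S"
  shows "has_matching R k S"
  using assms
proof (induction k arbitrary: S rule: nat_induct_at_least)
  case base
  have S: "S \<subseteq> V" and 4: "4 \<le> card S"
    using base by (auto simp: blue_free_def)
  obtain f :: "nat \<Rightarrow> nat" where f: "\<And>i. i < 4 \<Longrightarrow> f i \<in> S" "\<And>i j. i < j \<Longrightarrow> j < 4 \<Longrightarrow> f i < f j"
    using strict_sorted_enumeration[OF finite_subset_V[OF S] 4] by blast
  have ord: "f 0 < f 1" "f 1 < f 2" "f 2 < f 3"
    by (auto intro: f(2))
  have mem: "f 0 \<in> S" "f 1 \<in> S" "f 2 \<in> S" "f 3 \<in> S"
    by (auto intro: f(1))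
  have "R (f 0) (f 2)" "R (f 1) (f 3)"
    using R_or_M_blue_free[OF base(1)] mem ord by (fastforce simp: M_def)+
  then show ?case
    using mem ord by (intro has_matching_2[of "f 0" "f 2" "f 1" "f 3"]) auto
next
  case (Suc k)
  obtain x y where xy: "x \<in> S" "y \<in> S" "x \<noteq> y" "R x y"
    using red_edge_blue_free[OF Suc.prems(1)] Suc.prems(2) Suc.hyps by auto
  have "finite S"
    using Suc.prems(1) finite_subset_V by (simp add: blue_free_def)
  then have "has_matching R k (S - {x, y})"
    using Suc.prems xy by (intro Suc.IH) (auto intro: blue_free_subset)
  with xy show ?case by auto
qed

lemma red_blue_free_off_path:
  assumes "blue_free S" "q \<in> S" "2 * n \<le> q"
  shows "S - {q} \<subseteq> {y. R q y}"
  using assms R_or_B_off_path[of q] unfolding blue_free_def by blast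

lemma subset_path_card: "finite S \<Longrightarrow> 2 * n < card S \<Longrightarrow> \<exists>q\<in>S. 2 * n \<le> q"
  using card_mono[of "{..<2 * n}" S] by (metis card_lessThan finite_lessThan lessThan_iff not_le subsetI)

lemma card_blue_free:
  assumes "blue_free S"
  shows "card S \<le> 2 * n"
proof (rule ccontr)
  assume large: "\<not> ?thesis"
  have fin: "finite S"
    using assms finite_subset_V by (simp add: blue_free_def)
  then obtain q where q: "q \<in> S" "2 * n \<le> q"
    using large subset_path_card by (meson not_le)
  have "has_matching R n (S - {q})"
    using n_ge_2 large q(1) fin by (intro blue_free_matching blue_free_subset[OF assms]) auto
  then show False
    using no_fan red_blue_free_off_path[OF assms q] by blast
qed

lemma blue_free_blue_neighbourhood: "blue_free {y. B x y}"
  using B_V no_blue_triangle by (auto simp: blue_free_def)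

lemma finite_neighbourhoods: "finite {y. R x y}" "finite {y. B x y}"
  using R_V B_V by (blast intro: finite_subset_V)+

lemma card_blue: "card {y. B x y} \<le> 2 * n"
  using card_blue_free[OF blue_free_blue_neighbourhood] .

lemma card_red: "card {y. R x y} \<le> 2 * n + 1"
proof (rule ccontr)
  assume "\<not> ?thesis"
  then have "has_matching R n {y. R x y}"
    using n_ge_2 R_V by (intro matching_in_large_set) auto
  then show False
    using no_red_fan by blast
qed

text \<open>A non-red pair is blue or missing, and \<open>z\<close> lies in at most
  \<open>2 * n\<close> blue and two missing pairs.\<close>

lemma card_nonred:
  assumes "D \<subseteq> V" "z \<notin> D" "\<And>y. y \<in> D \<Longrightarrow> \<not> R z y" "z \<in> V"
  shows "card D \<le> 2 * n + 2"
proof -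
  have "D \<subseteq> {y. B z y} \<union> {y. M z y}"
    using assms R_B_M by blast
  then have "card D \<le> card ({y. B z y} \<union> {y. M z y})"
    using finite_neighbourhoods M_neighbours by (intro card_mono) auto
  also have "\<dots> \<le> card {y. B z y} + card {y. M z y}"
    by (rule card_Un_le)
  finally show ?thesis
    using card_blue[of z] M_neighbours[of z] by linarith
qed

lemma blue_edge_off_path:
  obtains v w where "B v w" "2 * n \<le> v" "2 * n \<le> w"
proof -
  have "\<not> blue_free {2 * n..<4 * n + 1}"
    using card_blue_free by fastforce
  then show thesis
    using that by (auto simp: blue_free_def V_def)
qed

subsection \<open>Neighbourhoods of a blue edge\<close>

definition A :: "nat \<Rightarrow> nat \<Rightarrow> nat set" where
  "A v w = {x. B v x} - {w}"

definition L :: "nat \<Rightarrow> nat \<Rightarrow> nat set" where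
  "L v w = {x. R v x \<and> R w x}"

definition off_path_edge :: "nat \<Rightarrow> nat \<Rightarrow> bool" where
  "off_path_edge v w \<longleftrightarrow> B v w \<and> 2 * n \<le> v \<and> 2 * n \<le> w"

text \<open>For a blue edge \<open>v w\<close> off the path, the remaining vertices split into \<open>A v w\<close>, \<open>A w v\<close> and \<open>L v w\<close>:
  a common blue neighbour would give a triangle, and neither \<open>v\<close> nor \<open>w\<close> lies in a missing pair.
  Moreover \<open>A v w \<union> L v w\<close> is in the red neighbourhood of \<open>w\<close> and hence has no red matching of size \<open>n\<close>.\<close>

lemma off_path_edge_sym: "off_path_edge v w \<Longrightarrow> off_path_edge w v"
  using B_sym by (auto simp: off_path_edge_def)

lemma L_commute: "L v w = L w v"
  by (auto simp: L_def)

lemma A_subset_V: "A v w \<subseteq> V" and L_subset_V: "L v w \<subseteq> V"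
  using B_V R_V by (auto simp: A_def L_def)

lemma A_V: "x \<in> A v w \<Longrightarrow> x \<in> V" and L_V: "x \<in> L v w \<Longrightarrow> x \<in> V"
  using A_subset_V L_subset_V by blast+

lemma finite_A: "finite (A v w)" and finite_L: "finite (L v w)"
  using finite_subset_V A_subset_V L_subset_V by blast+

lemma blue_free_A: "blue_free (A v w)"
  unfolding A_def by (rule blue_free_subset[OF blue_free_blue_neighbourhood]) blast

lemma disjoint_A_L: "A v w \<inter> L v w = {} \<and> A w v \<inter> L v w = {}"
  using not_R_and_B by (auto simp: A_def L_def)

lemma disjoint_A_A: "off_path_edge v w \<Longrightarrow> A v w \<inter> A w v = {}"
  using no_blue_triangle by (auto simp: A_def off_path_edge_def)

lemma V_cases:
  assumes "off_path_edge v w" "x \<in> V"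
  shows "x = v \<or> x = w \<or> x \<in> A v w \<or> x \<in> A w v \<or> x \<in> L v w"
  using assms R_or_B_off_path[of v x] R_or_B_off_path[of w x] B_V
  unfolding off_path_edge_def A_def L_def by blast

lemma A_L_red:
  assumes "off_path_edge v w"
  shows "A v w \<union> L v w \<subseteq> {y. R w y}"
proof -
  have "R w x" if "x \<in> A v w" for x
    using that assms R_or_B_off_path[of w x] B_V no_blue_triangle
    unfolding off_path_edge_def A_def by blast
  then show ?thesis
    by (auto simp: L_def)
qed

lemma no_matching_A_L: "off_path_edge v w \<Longrightarrow> S \<subseteq> A v w \<union> L v w \<Longrightarrow> \<not> has_matching R n S"
  using no_fan[of S w] A_L_red by blast

text \<open>Off the path, red and blue degree add up to \<open>4 * n\<close>. The red degree is at
  most \<open>2 * n + 1\<close>, so the blue one is \<open>2 * n - 1\<close> or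
  \<open>2 * n\<close>, and \<open>w\<close> is not counted.\<close>

lemma card_A_bounds:
  assumes "off_path_edge v w"
  shows "card (A v w) = 2 * n - 1 \<or> card (A v w) = 2 * n - 2"
proof -
  have w: "B v w" "v \<in> V"
    using assms B_V by (auto simp: off_path_edge_def)
  have "V - {v} \<subseteq> {x. B v x} \<union> {x. R v x}"
    using assms R_or_B_off_path[of v] w unfolding off_path_edge_def by blast
  then have "card (V - {v}) \<le> card ({x. B v x} \<union> {x. R v x})"
    using finite_neighbourhoods by (intro card_mono) auto
  also have "\<dots> \<le> card {x. B v x} + card {x. R v x}"
    by (rule card_Un_le)
  finally have "4 * n \<le> card {x. B v x} + card {x. R v x}"
    using w card_V by simp
  moreover have "card (A v w) = card {x. B v x} - 1"
    using w by (simp add: A_def)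
  ultimately show ?thesis
    using card_blue[of v] card_red[of v] by linarith
qed

lemma card_A_A_L:
  assumes "off_path_edge v w"
  shows "card (A v w) + card (A w v) + card (L v w) = 4 * n - 1"
proof -
  have vw: "v \<in> V" "w \<in> V" "v \<noteq> w"
    using assms B_V B_irrefl by (auto simp: off_path_edge_def)
  have "V - {v, w} = (A v w \<union> A w v) \<union> L v w"
  proof
    show "V - {v, w} \<subseteq> A v w \<union> A w v \<union> L v w"
      using V_cases[OF assms] by blast
    show "A v w \<union> A w v \<union> L v w \<subseteq> V - {v, w}"
      using B_V R_V R_irrefl B_irrefl by (auto simp: A_def L_def)
  qed
  moreover have "card ((A v w \<union> A w v) \<union> L v w) = card (A v w) + card (A w v) + card (L v w)"
    using disjoint_A_A[OF assms] disjoint_A_L[of v w] finite_A finite_L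
    by (subst card_Un_disjoint; (subst card_Un_disjoint)?) auto
  moreover have "card (V - {v, w}) = 4 * n - 1"
    using vw card_V by (subst card_Diff_subset) auto
  ultimately show ?thesis by simp
qed

section \<open>Excluding blue neighbourhoods of size 2n\<close>

text \<open>\<open>A v w\<close> alone carries a red matching of size \<open>n - 1\<close>, so a red
  edge in \<open>L v w\<close> would complete a fan around \<open>w\<close>.\<close>

lemma L_red_free:
  assumes "3 \<le> n" "off_path_edge v w" "z \<in> L v w" "z' \<in> L v w"
  shows "\<not> R z z'"
proof
  assume R: "R z z'"
  have "has_matching R (n - 1) (A v w)"
    using assms(1) card_A_bounds[OF assms(2)] blue_free_A by (intro blue_free_matching) auto
  then have "has_matching R (Suc (n - 1)) (insert z (insert z' (A v w)))"
    using R R_irrefl assms disjoint_A_L[of v w] by (intro has_matching_insert_edge) auto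
  then show False
    using no_matching_A_L[OF assms(2), of "insert z (insert z' (A v w))"] assms by auto
qed

text \<open>With the extra vertex, \<open>A v w\<close> still carries a red matching of size
  \<open>n - 1\<close> after \<open>a\<close> is used for the edge to \<open>z\<close>.\<close>

lemma A_L_red_free_if_full:
  assumes "3 \<le> n" "off_path_edge v w" "card (A v w) = 2 * n - 1" "z \<in> L v w" "a \<in> A v w"
  shows "\<not> R z a"
proof
  assume R: "R z a"
  have "has_matching R (n - 1) (A v w - {a})"
    using assms finite_A by (intro blue_free_matching blue_free_subset[OF blue_free_A]) auto
  then have "has_matching R (Suc (n - 1)) (insert z (insert a (A v w - {a})))"
    using R R_irrefl assms disjoint_A_L[of v w] by (intro has_matching_insert_edge) auto
  then show False
    using no_matching_A_L[OF assms(2), of "insert z (insert a (A v w - {a}))"] assms by auto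
qed

text \<open>The only vertex of \<open>L v w\<close> would be non-red to \<open>4 * n - 2\<close>
  vertices, more than \<open>card_nonred\<close> allows.\<close>

lemma not_both_full:
  assumes "3 \<le> n" "off_path_edge v w" "card (A v w) = 2 * n - 1" "card (A w v) = 2 * n - 1"
  shows False
proof -
  have "card (L v w) = 1"
    using card_A_A_L[OF assms(2)] assms by simp
  then obtain z where z: "z \<in> L v w"
    by (metis card_1_singletonE insertI1)
  have "card (A v w \<union> A w v) \<le> 2 * n + 2"
  proof (rule card_nonred)
    fix y assume "y \<in> A v w \<union> A w v"
    then show "\<not> R z y"
      using A_L_red_free_if_full assms z off_path_edge_sym L_commute by (metis UnE)
  qed (use z A_V L_V disjoint_A_L[of v w] in auto)
  moreover have "card (A v w \<union> A w v) = 4 * n - 2"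
    using assms disjoint_A_A finite_A by (subst card_Un_disjoint) auto
  ultimately show False
    using assms(1) by linarith
qed

text \<open>The two vertices of \<open>L v w\<close> form a missing pair, and one of them,
  \<open>z\<close>, is blue to some \<open>y\<close> in \<open>A w v\<close>. A vertex
  \<open>q\<close> of \<open>A v w\<close> off the path is then red to \<open>y\<close> and to the
  other blue neighbours of \<open>v\<close>; a red edge from \<open>y\<close> into
  \<open>A v w\<close> completes a fan around \<open>q\<close>.\<close>

lemma not_one_full:
  assumes n: "3 \<le> n" and e: "off_path_edge v w"
    and full: "card (A v w) = 2 * n - 1" and small: "card (A w v) = 2 * n - 2"
  shows False
proof -
  have vw: "B v w" "B w v" "v \<noteq> w"
    using e B_sym B_irrefl by (auto simp: off_path_edge_def)
  have "card (L v w) = 2"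
    using card_A_A_L[OF e] full small n by simp
  then obtain z1 z2 where z: "L v w = {z1, z2}" "z1 \<noteq> z2"
    by (meson card_2_iff)
  then have zV: "z1 \<in> V" "z2 \<in> V"
    using L_subset_V by blast+
  have zA: "z1 \<notin> A v w" "z2 \<notin> A v w" "z1 \<notin> A w v" "z2 \<notin> A w v"
    using disjoint_A_L[of v w] z by auto
  have nonred: "\<not> R z a" if "z \<in> {z1, z2}" "a \<in> A v w" for z a
    using A_L_red_free_if_full[OF n e full] that z by blast
  have "\<not> B z1 z2"
  proof
    assume "B z1 z2"
    \<comment> \<open>Neither pair is red, and two blue ones would close a triangle. At most four
      vertices can be missing with \<open>z1\<close> or \<open>z2\<close>, but \<open>A v w\<close>
      has at least five.\<close>
    have "M z1 a \<or> M z2 a" if "a \<in> A v w" for a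
      using nonred[of z1 a] nonred[of z2 a] R_B_M[of z1 a] R_B_M[of z2 a] zV zA A_V[OF that] that
        no_blue_triangle[OF \<open>B z1 z2\<close>, of a] by blast
    then have "A v w \<subseteq> {y. M z1 y} \<union> {y. M z2 y}"
      by blast
    then have "card (A v w) \<le> card ({y. M z1 y} \<union> {y. M z2 y})"
      using M_neighbours by (intro card_mono) auto
    also have "\<dots> \<le> card {y. M z1 y} + card {y. M z2 y}"
      by (rule card_Un_le)
    finally show False
      using M_neighbours[of z1] M_neighbours[of z2] full n by linarith
  qed
  then have Mz: "M z1 z2"
    using L_red_free[OF n e, of z1 z2] R_B_M zV z by auto
  obtain z z' y where zz': "{z, z'} = {z1, z2}" and y: "y \<in> A w v" "B z y"
  proof (rule ccontr)
    assume "\<not> thesis"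
    then have no: "\<not> B z y" if "z \<in> {z1, z2}" "y \<in> A w v" for z y
      using \<open>\<And>z z' y. \<lbrakk>{z, z'} = {z1, z2}; y \<in> A w v; B z y\<rbrakk> \<Longrightarrow> thesis\<close> that by blast
    \<comment> \<open>Without blue edges to \<open>A w v\<close>, both vertices extend the blue
      neighbourhood of \<open>w\<close> to a blue-free set that is too large.\<close>
    let ?S = "insert z1 (insert z2 {x. B w x})"
    have eq: "{x. B w x} = insert v (A w v)"
      using vw by (auto simp: A_def)
    have vz: "\<not> B v z1" "\<not> B v z2"
      using z not_R_and_B by (auto simp: L_def)
    have "blue_free (insert z2 {x. B w x})"
      using no vz B_sym zV by (intro blue_free_insert blue_free_blue_neighbourhood) (auto simp: eq)
    then have "blue_free ?S"
      by (rule blue_free_insert) (use no vz B_sym zV \<open>\<not> B z1 z2\<close> in \<open>auto simp: eq\<close>)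
    moreover have "card ?S = 2 * n + 1"
    proof -
      have "v \<notin> A w v" "z1 \<noteq> v" "z2 \<noteq> v"
        using z R_irrefl by (auto simp: A_def L_def)
      then show ?thesis
        unfolding eq using zA z(2) small n finite_A by simp
    qed
    ultimately show False
      using card_blue_free[of ?S] by linarith
  qed
  have z_in: "z \<in> {z1, z2}" "z' \<in> {z1, z2}" "z \<in> V" "z \<notin> A v w" and Mzz': "M z z'"
    using zz' zV zA Mz M_sym z(2) by (auto simp: doubleton_eq_iff)
  have blue_or_M: "B z a \<or> M z a" if "a \<in> A v w" for a
    using that nonred z_in R_B_M A_subset_V by (metis subsetD)
  \<comment> \<open>\<open>q\<close> is going to be the centre of a red fan on \<open>{u. B v u}\<close> and \<open>y\<close>.\<close>
  obtain q where q: "q \<in> A v w" "2 * n \<le> q" "B z q"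
  proof -
    have "card (insert z1 (insert z2 (A v w))) = 2 * n + 1"
      using zA z(2) full n finite_A by simp
    then obtain q where "q \<in> insert z1 (insert z2 (A v w))" "2 * n \<le> q"
      using subset_path_card[of "insert z1 (insert z2 (A v w))"] finite_A by auto
    moreover from this have "q \<in> A v w"
      using Mz by (auto simp: M_def)
    moreover from calculation have "B z q"
      using blue_or_M by (fastforce simp: M_def)
    ultimately show thesis
      using that by blast
  qed
  have yV: "y \<in> V" "y \<notin> A v w" "y \<noteq> w"
    using y A_subset_V disjoint_A_A[OF e] vw B_irrefl by (auto simp: A_def)
  have Rqy: "R q y"
    using R_or_B_off_path[of q y] q y yV no_blue_triangle B_sym A_subset_V by blast
  obtain x where x: "x \<in> A v w" "x \<noteq> q" "R y x"
  proof (rule ccontr)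
    assume "\<not> thesis"
    then have no: "\<not> R y x" if "x \<in> A v w" "x \<noteq> q" for x
      using \<open>\<And>x. \<lbrakk>x \<in> A v w; x \<noteq> q; R y x\<rbrakk> \<Longrightarrow> thesis\<close> that by blast
    \<comment> \<open>A blue neighbour of \<open>z\<close> is not blue to \<open>y\<close>, so every
      \<open>u\<close> is missing with \<open>z\<close> or with \<open>y\<close>. Since
      \<open>z'\<close> takes up one missing pair of \<open>z\<close>, at most 1 + 2 vertices are
      covered, fewer than \<open>2 * n - 2\<close>.\<close>
    have "A v w - {q} \<subseteq> ({u. M z u} - {z'}) \<union> {u. M y u}"
    proof
      fix u assume u: "u \<in> A v w - {q}"
      then have "u \<noteq> z'"
        using zA z_in by auto
      show "u \<in> ({u. M z u} - {z'}) \<union> {u. M y u}"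
      proof (cases "B z u")
        case True
        then have "\<not> B y u"
          using y no_blue_triangle B_sym by blast
        then show ?thesis
          using no u R_B_M[of y u] yV A_subset_V by blast
      next
        case False
        then show ?thesis
          using blue_or_M u \<open>u \<noteq> z'\<close> by blast
      qed
    qed
    then have "card (A v w - {q}) \<le> card (({u. M z u} - {z'}) \<union> {u. M y u})"
      using M_neighbours by (intro card_mono) auto
    also have "\<dots> \<le> card ({u. M z u} - {z'}) + card {u. M y u}"
      by (rule card_Un_le)
    also have "\<dots> \<le> 1 + 2"
      using M_neighbours[of z] M_neighbours[of y] Mzz' by (intro add_mono) auto
    finally show False
      using q(1) full n finite_A by simp
  qed
  \<comment> \<open>The edge from \<open>y\<close> uses up \<open>x\<close>; the other
    \<open>2 * n - 2\<close> blue neighbours of \<open>v\<close> are matched among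
    themselves.\<close>
  let ?T = "{u. B v u} - {q, x}"
  have "q \<in> {u. B v u}" "x \<in> {u. B v u}" "card {u. B v u} = 2 * n"
    using q x full vw n finite_neighbourhoods by (auto simp: A_def)
  then have "card ?T = 2 * n - 2"
    using x by (subst card_Diff_subset) auto
  then have "has_matching R (n - 1) ?T"
    using n by (intro blue_free_matching blue_free_subset[OF blue_free_blue_neighbourhood]) auto
  moreover have "y \<notin> {u. B v u}"
    using yV by (auto simp: A_def)
  ultimately have "has_matching R (Suc (n - 1)) (insert y (insert x ?T))"
    using x R_irrefl by (intro has_matching_insert_edge) auto
  moreover have "insert y (insert x ?T) \<subseteq> {u. R q u}"
    using red_blue_free_off_path[OF blue_free_blue_neighbourhood, of q v] q Rqy x
    by (auto simp: A_def)
  ultimately show False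
    using no_fan n by (metis Suc_diff_1 less_le_trans zero_less_numeral)
qed

section \<open>Red edges between \<open>L\<close> and \<open>A\<close> when \<open>L\<close> has
  three vertices\<close>

text \<open>The non-red pairs at distance at least 2 are blue, so three pairwise distant vertices,
  two of them in \<open>S\<close>, would form a blue triangle.\<close>

lemma no_two_nonred_triples:
  assumes LD: "S \<subseteq> V" "D \<subseteq> V" "S \<inter> D = {}" and card: "3 \<le> card S" "3 \<le> card D"
    and SS: "\<And>z z'. z \<in> S \<Longrightarrow> z' \<in> S \<Longrightarrow> \<not> R z z'"
    and SD: "\<And>z d. z \<in> S \<Longrightarrow> d \<in> D \<Longrightarrow> \<not> R z d"
  shows False
proof -
  obtain f :: "nat \<Rightarrow> nat" where f: "\<And>i. i < 3 \<Longrightarrow> f i \<in> S" "\<And>i j. i < j \<Longrightarrow> j < 3 \<Longrightarrow> f i < f j"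
    using strict_sorted_enumeration[OF finite_subset_V[OF LD(1)] card(1)] by blast
  define x y z where "x = f 0" and "y = f 1" and "z = f 2"
  have S: "x \<in> S" "y \<in> S" "z \<in> S" and ord: "x < y" "y < z"
    unfolding x_def y_def z_def by (auto intro: f)
  define far where "far p q \<longleftrightarrow> p + 2 \<le> q \<or> q + 2 \<le> p" for p q :: nat
  have blue: "B p q" if "far p q" "p \<in> S" "q \<in> S \<union> D" for p q
  proof -
    have "p \<noteq> q" "\<not> M p q"
      using that(1) by (auto simp: far_def M_def)
    then show ?thesis
      using R_B_M[of p q] that(2,3) SS SD LD by blast
  qed
  have spread: "\<not> (far p q \<and> far q d \<and> far p d)" if "p \<in> S" "q \<in> S" "d \<in> S \<union> D" for p q d
    using blue that no_blue_triangle by blast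
  \<comment> \<open>Missing pairs must destroy every triangle inside \<open>S \<union> {d}\<close>, which leaves two positions for \<open>d\<close>.\<close>
  have D: "d \<in> (if y = Suc x \<and> z = Suc y then {x - 1, Suc z} else if y = Suc x then {z - 1, Suc z}
      else {x - 1, Suc x})" if "d \<in> D" for d
  proof -
    have "d \<noteq> x" "d \<noteq> y" "d \<noteq> z"
      using that S LD by auto
    moreover note spread[of x y z] spread[of x y d] spread[of x z d] spread[of y z d]
    ultimately show ?thesis
      using that S ord by (auto simp: far_def)
  qed
  then have "\<exists>p q. D \<subseteq> {p, q}"
    by (metis (no_types, lifting) subsetI)
  then obtain p q where "D \<subseteq> {p, q}" by blast
  then have "card D \<le> card {p, q}"
    by (intro card_mono) auto
  then show False
    using card(2) by (simp add: card_insert_if split: if_splits)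
qed

text \<open>Two disjoint red edges between \<open>L v w\<close> and \<open>A v w\<close> would
  extend such a matching to size \<open>n\<close> in the red neighbourhood of
  \<open>w\<close>.\<close>

lemma crossing_red_edges:
  assumes "off_path_edge v w" "z \<in> L v w" "z' \<in> L v w" "z \<noteq> z'" "a \<in> A v w" "a' \<in> A v w" "a \<noteq> a'"
    and "R z a" "R z' a'"
  shows "\<not> has_matching R (n - 2) (A v w - {a, a'})"
proof
  let ?S = "A v w - {a, a'}"
  assume "has_matching R (n - 2) ?S"
  then have "has_matching R (Suc (n - 2)) (insert z (insert a ?S))"
    using assms disjoint_A_L[of v w] by (intro has_matching_insert_edge) auto
  then have "has_matching R (Suc (Suc (n - 2))) (insert z' (insert a' (insert z (insert a ?S))))"
    by (rule has_matching_insert_edge) (use assms disjoint_A_L[of v w] in auto)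
  moreover have "Suc (Suc (n - 2)) = n"
    using n_ge_2 by simp
  moreover have "insert z' (insert a' (insert z (insert a ?S))) \<subseteq> A v w \<union> L v w"
    using assms by auto
  ultimately show False
    using no_matching_A_L[OF assms(1)] by metis
qed

text \<open>Without two disjoint edges, the red graph between \<open>L v w\<close> and
  \<open>A v w\<close> is a star. If its centre had to be a vertex \<open>a\<close> of
  \<open>A v w\<close>, then \<open>L v w\<close> and \<open>A v w - {a}\<close> would contradict
  \<open>no_two_nonred_triples\<close>.\<close>

lemma red_star:
  assumes n: "3 \<le> n" and e: "off_path_edge v w"
    and small: "card (A v w) = 2 * n - 2" and L3: "card (L v w) = 3"
    and no_crossing: "\<And>z z' a a'. z \<in> L v w \<Longrightarrow> z' \<in> L v w \<Longrightarrow> z \<noteq> z' \<Longrightarrow>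
      a \<in> A v w \<Longrightarrow> a' \<in> A v w \<Longrightarrow> a \<noteq> a' \<Longrightarrow> R z a \<Longrightarrow> \<not> R z' a'"
  obtains z where "z \<in> L v w" "\<And>z' a. z' \<in> L v w \<Longrightarrow> z' \<noteq> z \<Longrightarrow> a \<in> A v w \<Longrightarrow> \<not> R z' a"
proof -
  have "\<exists>z\<in>L v w. \<forall>z'\<in>L v w. z' \<noteq> z \<longrightarrow> (\<forall>a\<in>A v w. \<not> R z' a)"
  proof (rule ccontr)
    assume no: "\<not> ?thesis"
    obtain z0 where "z0 \<in> L v w"
      using L3 by (metis card.empty ex_in_conv zero_neq_numeral)
    with no obtain z a where z: "z \<in> L v w" "a \<in> A v w" "R z a"
      by blast
    with no obtain z' a' where z': "z' \<in> L v w" "z' \<noteq> z" "a' \<in> A v w" "R z' a'"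
      by blast
    then have "a' = a"
      using no_crossing z by blast
    then have at_a: "\<not> R u b" if "u \<in> L v w" "b \<in> A v w - {a}" for u b
      using that no_crossing[of z u a b] no_crossing[of z' u a b] z z' by blast
    show False
    proof (rule no_two_nonred_triples[of "L v w" "A v w - {a}"])
      show "3 \<le> card (A v w - {a})"
        using z small n finite_A by simp
    qed (use L_V A_V disjoint_A_L[of v w] L3 at_a L_red_free[OF n e] in auto)
  qed
  then show thesis
    using that by blast
qed

text \<open>The other two vertices of \<open>L v w\<close> are non-red to \<open>z\<close> as well,
  which lowers the bound of \<open>card_nonred\<close> by 2.\<close>

lemma L_card_nonred:
  assumes "3 \<le> n" "off_path_edge v w" "card (L v w) = 3" "z \<in> L v w" "D \<subseteq> A v w \<union> A w v"
    "\<And>a. a \<in> D \<Longrightarrow> \<not> R z a"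
  shows "card D \<le> 2 * n"
proof -
  have fin: "finite D"
    using assms(5) finite_A finite_subset by blast
  have "card (D \<union> (L v w - {z})) \<le> 2 * n + 2"
    using assms A_V L_V disjoint_A_L[of v w] L_red_free[OF assms(1,2,4)]
    by (intro card_nonred[of _ z]) blast+
  moreover have "card (D \<union> (L v w - {z})) = card D + card (L v w - {z})"
    using assms(5) disjoint_A_L[of v w] finite_L fin by (intro card_Un_disjoint) auto
  moreover have "card (L v w - {z}) = 2"
    using assms finite_L by simp
  ultimately show ?thesis by linarith
qed

text \<open>A vertex of \<open>L v w\<close> that is neither centre is non-red to all
  \<open>4 * n - 4\<close> vertices of \<open>A v w\<close> and \<open>A w v\<close>.\<close>

lemma not_two_stars:
  assumes n: "3 \<le> n" and e: "off_path_edge v w" and L3: "card (L v w) = 3"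
    and small: "card (A v w) = 2 * n - 2" "card (A w v) = 2 * n - 2"
    and z: "\<And>u a. u \<in> L v w \<Longrightarrow> u \<noteq> z \<Longrightarrow> a \<in> A v w \<Longrightarrow> \<not> R u a"
    and z': "\<And>u a. u \<in> L v w \<Longrightarrow> u \<noteq> z' \<Longrightarrow> a \<in> A w v \<Longrightarrow> \<not> R u a"
  shows False
proof -
  have "\<not> L v w \<subseteq> {z, z'}"
    using card_mono[of "{z, z'}" "L v w"] L3 by (auto simp: card_insert_if split: if_splits)
  then obtain u where "u \<in> L v w" "u \<noteq> z" "u \<noteq> z'"
    by blast
  then have "card (A v w \<union> A w v) \<le> 2 * n"
    using z z' by (intro L_card_nonred[OF n e L3]) auto
  moreover have "card (A v w \<union> A w v) = 4 * n - 4"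
    using small disjoint_A_A[OF e] finite_A by (subst card_Un_disjoint) auto
  ultimately show False
    using n by linarith
qed

subsection \<open>Crossing red edges\<close>

lemma no_three_M:
  assumes "M d x" "M d y" "M d z" "x \<noteq> y" "x \<noteq> z" "y \<noteq> z"
  shows False
  using assms by (auto simp: M_def)

lemma no_M_cycle:
  assumes "M a c" "M a d" "M b c" "M b d" "a \<noteq> b" "c \<noteq> d"
  shows False
  using assms by (auto simp: M_def)

text \<open>The two vertices left over are too few for \<open>blue_free_matching\<close>; the
  crossing shows instead that their pair is missing. That it is not red is recorded too, as
  \<open>M\<close> does not imply it.\<close>

lemma crossing_red_edges_3:
  assumes "n = 3" "off_path_edge v w" "z \<in> L v w" "z' \<in> L v w" "z \<noteq> z'" "A v w = {a, b, c, d}" "distinct [a, b, c, d]"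
    and "R z a" "R z' b"
  shows "M c d \<and> \<not> R c d"
proof -
  have "\<not> has_matching R 1 {c, d}"
  proof -
    have "A v w - {a, b} = {c, d}"
      using assms(6,7) by auto
    then show ?thesis
      using crossing_red_edges[of v w z z' a b] assms by simp
  qed
  then have "\<not> R c d"
    using has_matching_1[of c "{c, d}" d R] assms(7) by auto
  moreover have "R c d \<or> M c d"
    using R_or_M_blue_free[OF blue_free_A, of c v w d] assms(6,7) by auto
  ultimately show ?thesis by blast
qed

text \<open>\<open>L v w\<close> is red-free, and five vertices never are.\<close>

lemma five_not_red_free:
  assumes "n = 3" "off_path_edge v w" "card (L v w) = 3" "c \<in> A v w" "d \<in> A v w" "c \<noteq> d" "\<not> R c d"
  obtains u e where "u \<in> L v w" "e \<in> {c, d}" "R u e"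
proof -
  have "card (L v w \<union> {c, d}) = card (L v w) + card {c, d}"
    using assms finite_L disjoint_A_L[of v w] by (intro card_Un_disjoint) auto
  then have "5 \<le> card (L v w \<union> {c, d})"
    using assms by simp
  moreover have "L v w \<union> {c, d} \<subseteq> V"
    using assms L_subset_V A_V by blast
  ultimately obtain x y where xy: "x \<in> L v w \<union> {c, d}" "y \<in> L v w \<union> {c, d}" "x \<noteq> y" "R x y"
    using red_edge_in_five by metis
  have "\<not> (x \<in> L v w \<and> y \<in> L v w)"
    using xy L_red_free assms by blast
  moreover have "\<not> (x \<in> {c, d} \<and> y \<in> {c, d})"
    using xy assms R_sym by blast
  ultimately show thesis
    using xy that[of x y] that[of y x] R_sym by blast
qed

text \<open>Each crossing forces a missing pair on the rest of \<open>A v w\<close>. The crossings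
  found here would force a 4-cycle or three missing pairs at one vertex, while missing pairs form a
  path.\<close>

lemma not_two_red_pairs:
  assumes n: "n = 3" and e: "off_path_edge v w" and L3: "card (L v w) = 3" and small: "card (A v w) = 4"
    and z: "z \<in> L v w" "z' \<in> L v w" "z \<noteq> z'"
    and two: "2 \<le> card {a \<in> A v w. R z a}" "2 \<le> card {a \<in> A v w. R z' a}"
  shows False
proof -
  have pair: "\<exists>a b. a \<in> A v w \<and> b \<in> A v w \<and> a \<noteq> b \<and> R u a \<and> R u b" if two': "2 \<le> card {a \<in> A v w. R u a}" for u
  proof -
    obtain T where "T \<subseteq> {a \<in> A v w. R u a}" "card T = 2"
      using two' by (meson obtain_subset_with_card_n)
    then show ?thesis
      by (auto simp: card_2_iff)
  qed
  obtain a b where ab: "a \<in> A v w" "b \<in> A v w" "a \<noteq> b" "R z a" "R z b"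
    using pair[OF two(1)] by blast
  have "card (A v w - {a, b}) = 2"
    using ab small finite_A by (subst card_Diff_subset) auto
  then obtain c d where cd: "A v w - {a, b} = {c, d}" "c \<noteq> d"
    by (meson card_2_iff)
  then have A: "A v w = {a, b, c, d}" and dist: "distinct [a, b, c, d]"
    using ab by auto
  have X: "M r s \<and> \<not> R r s" if "u \<in> L v w" "u' \<in> L v w" "u \<noteq> u'" "R u p" "R u' q"
      "{a, b, c, d} = {p, q, r, s}" "distinct [p, q, r, s]" for u u' p q r s
    using crossing_red_edges_3[OF n e that(1-3) _ that(7) that(4,5)] that(6) A by simp
  obtain p q where pq: "p \<in> A v w" "q \<in> A v w" "p \<noteq> q" "R z' p" "R z' q"
    using pair[OF two(2)] by blast
  \<comment> \<open>If \<open>z'\<close> is red to \<open>c\<close>, then \<open>a\<close> and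
    \<open>b\<close> are both missing with \<open>d\<close>; likewise with \<open>c\<close> and
    \<open>d\<close> exchanged. The second red neighbour of \<open>z'\<close> then yields one
    missing pair too many.\<close>
  have "R z' a \<and> R z' b"
  proof (rule ccontr)
    assume no: "\<not> ?thesis"
    have 1: "R z' a \<Longrightarrow> M c d" and 2: "R z' b \<Longrightarrow> M c d"
      using X[of z z' b a c d] X[of z z' a b c d] z ab dist by auto
    have 3: "R z' c \<Longrightarrow> M b d \<and> M a d" and 4: "R z' d \<Longrightarrow> M b c \<and> M a c"
      using X[of z z' a c b d] X[of z z' b c a d] X[of z z' a d b c] X[of z z' b d a c] z ab dist
      by auto
    have "(R z' c \<and> R z' d) \<or> ((R z' a \<or> R z' b) \<and> (R z' c \<or> R z' d))"
      using pq no A by auto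
    then show False
      using 1 2 3 4 no_three_M[of d a b c] no_three_M[of c a b d] no_M_cycle[of a c d b] dist M_sym
      by (metis distinct_length_2_or_more)
  qed
  then have Rz': "R z' a" "R z' b" by auto
  then have "M c d" "\<not> R c d"
    using X[of z z' a b c d] z ab dist by auto
  then obtain u f where u: "u \<in> L v w" "f \<in> {c, d}" "R u f"
    using five_not_red_free[OF n e L3, of c d] A cd(2) by auto
  obtain g where g: "{c, d} = {f, g}" "f \<noteq> g"
    using u(2) cd(2) by auto
  obtain u' where u': "u' \<in> L v w" "u' \<noteq> u" "R u' a" "R u' b"
    using z ab Rz' by metis
  have "distinct [a, b, f, g]" "{a, b, c, d} = {a, b, f, g}"
    using dist g by auto
  \<comment> \<open>The red edge from \<open>u\<close> to \<open>f\<close> crosses both edges of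
    \<open>u'\<close>; together with \<open>f\<close> this makes three missing pairs at
    \<open>g\<close>.\<close>
  then have "M b g" "M a g"
    using X[of u' u a f b g] X[of u' u b f a g] u u' by auto
  moreover have "M f g"
    using \<open>M c d\<close> g M_sym by (auto simp: doubleton_eq_iff)
  ultimately show False
    using no_three_M[of g a b f] M_sym \<open>distinct [a, b, f, g]\<close> by auto
qed

text \<open>A crossing puts three vertices of \<open>A v w\<close> and two of \<open>L v w\<close>
  on the path, leaving at most one of its six vertices for \<open>A w v\<close>. So nothing crosses
  on that side, and the resulting star gives two vertices of \<open>L v w\<close> with at least two
  red neighbours each in \<open>A v w\<close>.\<close>

lemma no_crossing_3:
  assumes n: "n = 3" and e: "off_path_edge v w" and L3: "card (L v w) = 3"
    and small: "card (A v w) = 4" "card (A w v) = 4"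
    and z: "z \<in> L v w" "z' \<in> L v w" "z \<noteq> z'" "a \<in> A v w" "b \<in> A v w" "a \<noteq> b" "R z a"
  shows "\<not> R z' b"
proof
  assume "R z' b"
  have e': "off_path_edge w v" and L3': "card (L w v) = 3"
    using e off_path_edge_sym L3 L_commute by auto
  have "card (A v w - {a, b}) = 2"
    using z small finite_A by (subst card_Diff_subset) auto
  then obtain c d where cd: "A v w - {a, b} = {c, d}" "c \<noteq> d"
    by (meson card_2_iff)
  then have A: "A v w = {a, b, c, d}" and dist: "distinct [a, b, c, d]"
    using z by auto
  have Mcd: "M c d" "\<not> R c d"
    using crossing_red_edges_3[OF n e z(1-3) A dist z(7) \<open>R z' b\<close>] by auto
  then obtain u f where u: "u \<in> L v w" "f \<in> {c, d}" "R u f"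
    using five_not_red_free[OF n e L3, of c d] A cd(2) by auto
  obtain g where g: "{c, d} = {f, g}" "f \<noteq> g"
    using u(2) cd(2) by auto
  have dist': "distinct [a, b, f, g]" and A': "A v w = {a, b, f, g}"
    using dist g A by auto
  have fg: "M f g"
    using Mcd g M_sym by (auto simp: doubleton_eq_iff)
  obtain h where h: "h \<in> {a, b}" "M h g"
  proof (cases "u = z")
    case True
    then have "M a g"
      using crossing_red_edges_3[OF n e u(1) z(2), of f b a g] z A' dist' u \<open>R z' b\<close> by auto
    then show ?thesis using that by blast
  next
    case False
    then have "M b g"
      using crossing_red_edges_3[OF n e u(1) z(1), of f a b g] z A' dist' u by auto
    then show ?thesis using that by blast
  qed
  \<comment> \<open>\<open>L v w\<close> has no red edge, so without a missing pair it would be a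
    blue triangle.\<close>
  obtain s t where st: "s \<in> L v w" "t \<in> L v w" "s \<noteq> t" "M s t"
  proof (rule ccontr)
    assume "\<not> thesis"
    then have no: "\<not> M s t" if "s \<in> L v w" "t \<in> L v w" "s \<noteq> t" for s t
      using \<open>\<And>s t. \<lbrakk>s \<in> L v w; t \<in> L v w; s \<noteq> t; M s t\<rbrakk> \<Longrightarrow> thesis\<close> that by blast
    obtain x y z where L: "L v w = {x, y, z}" "x \<noteq> y" "x \<noteq> z" "y \<noteq> z"
      using L3 by (auto simp: card_3_iff)
    have "B p q" if "p \<in> L v w" "q \<in> L v w" "p \<noteq> q" for p q
      using that no L_red_free[OF _ e] n R_B_M L_V by (metis order_refl)
    then have "B x y" "B y z" "B x z"
      using L by auto
    then show False
      using no_blue_triangle by blast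
  qed
  \<comment> \<open>The path has 6 vertices, of which at least 5 lie outside \<open>A w v\<close>.\<close>
  have few: "\<not> M p q" if "p \<in> A w v" "q \<in> A w v" "p \<noteq> q" for p q
  proof
    assume "M p q"
    then have "p < 6" "q < 6" "f < 6" "g < 6" "h < 6" "s < 6" "t < 6"
      using fg h(2) st(4) n unfolding M_def by auto
    then have "{f, g, h} \<union> {s, t} \<union> {p, q} \<subseteq> {..<6}"
      by simp
    then have "card ({f, g, h} \<union> {s, t} \<union> {p, q}) \<le> card {..<6::nat}"
      by (rule card_mono[rotated]) simp
    moreover have "{f, g, h} \<subseteq> A v w"
      using A' h by auto
    then have "({f, g, h} \<union> {s, t}) \<inter> {p, q} = {}" "{f, g, h} \<inter> {s, t} = {}"
      using that st disjoint_A_L[of v w] disjoint_A_A[OF e] by blast+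
    then have "card ({f, g, h} \<union> {s, t} \<union> {p, q}) = card {f, g, h} + card {s, t} + card {p, q}"
      by (subst card_Un_disjoint; (subst card_Un_disjoint)?) auto
    moreover have "card {f, g, h} = 3"
      using dist' h(1) by auto
    ultimately show False
      using st(3) that(3) by simp
  qed
  obtain z3 where z3: "\<And>u x. u \<in> L v w \<Longrightarrow> u \<noteq> z3 \<Longrightarrow> x \<in> A w v \<Longrightarrow> \<not> R u x"
  proof (rule red_star[OF _ e'])
    show "3 \<le> n" "card (A w v) = 2 * n - 2" "card (L w v) = 3"
      using n small L3' by auto
    show "\<not> R p' x'" if p: "p \<in> L w v" "p' \<in> L w v" "p \<noteq> p'" "x \<in> A w v" "x' \<in> A w v" "x \<noteq> x'" "R p x"
      for p p' x x'
    proof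
      assume R': "R p' x'"
      have "card (A w v - {x, x'}) = 2"
        using p small finite_A by (subst card_Diff_subset) auto
      then obtain y y' where y: "A w v - {x, x'} = {y, y'}" "y \<noteq> y'"
        by (meson card_2_iff)
      then have "A w v = {x, x', y, y'}" "distinct [x, x', y, y']"
        using p by auto
      then have "M y y'"
        using crossing_red_edges_3[OF n e' p(1-3) _ _ p(7) R'] by blast
      then show False
        using few y by blast
    qed
  qed (use L_commute that in auto)
  \<comment> \<open>At most six vertices of \<open>A v w\<close> and \<open>A w v\<close> are
    non-red to \<open>u\<close>. All four of \<open>A w v\<close> are, which leaves at most two of
    the four in \<open>A v w\<close>.\<close>
  have two: "2 \<le> card {x \<in> A v w. R u x}" if "u \<in> L v w" "u \<noteq> z3" for u
  proof -
    let ?D = "A w v \<union> {x \<in> A v w. \<not> R u x}"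
    have "card ?D \<le> 2 * n"
      by (rule L_card_nonred[OF _ e L3 that(1)]) (use n z3 that in auto)
    moreover have "card ?D = card (A w v) + card {x \<in> A v w. \<not> R u x}"
      using disjoint_A_A[OF e] finite_A by (intro card_Un_disjoint) auto
    moreover have "card (A v w) = card {x \<in> A v w. R u x} + card {x \<in> A v w. \<not> R u x}"
      using finite_A by (subst card_Un_disjoint[symmetric]) (auto intro!: arg_cong[of _ _ card])
    ultimately show ?thesis
      using small n by linarith
  qed
  have "\<not> card (L v w - {z3}) \<le> Suc 0"
    using L3 finite_L by (simp add: card_Diff_singleton_if)
  then obtain u u' where "u \<in> L v w - {z3}" "u' \<in> L v w - {z3}" "u \<noteq> u'"
    using card_le_Suc0_iff_eq[of "L v w - {z3}"] finite_L by blast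
  then show False
    using not_two_red_pairs[OF n e L3 small(1), of u u'] two by auto
qed

text \<open>For \<open>n\<close> at least 4, the \<open>2 * n - 4\<close> other vertices of
  \<open>A v w\<close> carry a matching of size \<open>n - 2\<close>; only \<open>n = 3\<close>
  needs its own argument.\<close>

lemma no_crossing:
  assumes n: "3 \<le> n" and e: "off_path_edge v w" and L3: "card (L v w) = 3"
    and small: "card (A v w) = 2 * n - 2" "card (A w v) = 2 * n - 2"
    and z: "z \<in> L v w" "z' \<in> L v w" "z \<noteq> z'" "a \<in> A v w" "b \<in> A v w" "a \<noteq> b" "R z a"
  shows "\<not> R z' b"
proof (cases "n = 3")
  case True
  then show ?thesis
    using no_crossing_3[OF True e L3 _ _ z] small by simp
next
  case False
  have "card (A v w - {a, b}) = 2 * n - 4"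
    using z small finite_A by (subst card_Diff_subset) auto
  then have "has_matching R (n - 2) (A v w - {a, b})"
    using False n by (intro blue_free_matching blue_free_subset[OF blue_free_A]) auto
  then show ?thesis
    using crossing_red_edges[OF e z(1-6) z(7)] by blast
qed

text \<open>This collects the contradiction for all larger \<open>n\<close>; together with
  \<open>n_neq_2\<close> it shows that no such colouring exists.\<close>

lemma n_eq_2: "n = 2"
proof (rule ccontr)
  assume "n \<noteq> 2"
  then have n: "3 \<le> n"
    using n_ge_2 by simp
  obtain v w where e: "off_path_edge v w"
    using blue_edge_off_path by (metis off_path_edge_def)
  then have e': "off_path_edge w v"
    by (rule off_path_edge_sym)
  have small: "card (A v w) = 2 * n - 2" "card (A w v) = 2 * n - 2"
    using card_A_bounds[OF e] card_A_bounds[OF e'] not_both_full[OF n e]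
      not_one_full[OF n e] not_one_full[OF n e'] by blast+
  then have L3: "card (L v w) = 3"
    using card_A_A_L[OF e] n by linarith
  then have L3': "card (L w v) = 3"
    using L_commute by simp
  have star: "\<exists>z. \<forall>u\<in>L x y. u \<noteq> z \<longrightarrow> (\<forall>a\<in>A x y. \<not> R u a)"
    if xy: "off_path_edge x y" "card (L x y) = 3" "card (A x y) = 2 * n - 2" "card (A y x) = 2 * n - 2" for x y
    using red_star[OF n xy(1,3,2)] no_crossing[OF n xy] by (smt (verit))
  obtain z where z: "\<And>u a. u \<in> L v w \<Longrightarrow> u \<noteq> z \<Longrightarrow> a \<in> A v w \<Longrightarrow> \<not> R u a"
    using star[OF e L3 small] by blast
  obtain z' where z': "\<And>u a. u \<in> L v w \<Longrightarrow> u \<noteq> z' \<Longrightarrow> a \<in> A w v \<Longrightarrow> \<not> R u a"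
    using star[OF e' L3' small(2,1)] L_commute by blast
  show False
    using not_two_stars[OF n e L3 small z z'] by blast
qed

subsection \<open>Nine vertices\<close>

text \<open>The arguments above use \<open>blue_free_matching\<close> for matchings of size \<open>n - 1\<close>, which fails for \<open>n = 2\<close>;
  nine vertices are few enough for a propositional search.\<close>

lemma n_neq_2: "n \<noteq> 2"
proof
  assume n: "n = 2"
  define S :: "nat set" where "S = {0, 1, 2, 3, 4, 5, 6, 7, 8}"
  \<comment> \<open>Ordering the arguments gives one propositional atom per unordered pair.\<close>
  define r where "r x y \<longleftrightarrow> R (min x y) (max x y)" for x y
  have S: "S \<subseteq> V"
    using n unfolding S_def V_def by auto
  have r: "r x y \<longleftrightarrow> R x y" for x y
    using R_sym by (auto simp: r_def min_def max_def)
  \<comment> \<open>The guards leave out consecutive vertices below 4, whose pairs may be missing;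
    the outer two of three increasing vertices never form such a pair.\<close>
  have T: "\<forall>x\<in>S. \<forall>y\<in>S. x < y \<and> (Suc x < y \<or> 4 \<le> y) \<longrightarrow>
      (\<forall>z\<in>S. y < z \<and> (Suc y < z \<or> 4 \<le> z) \<longrightarrow> r x y \<or> r y z \<or> r x z)"
  proof (intro ballI impI)
    fix x y z assume xyz: "x \<in> S" "y \<in> S" "z \<in> S"
      and *: "x < y \<and> (Suc x < y \<or> 4 \<le> y)" "y < z \<and> (Suc y < z \<or> 4 \<le> z)"
    then have "\<not> M x y" "\<not> M y z" "\<not> M x z"
      using n unfolding M_def by auto
    then show "r x y \<or> r y z \<or> r x z"
      using R_B_M[of x y] R_B_M[of y z] R_B_M[of x z] no_blue_triangle[of x y z] xyz S *
      unfolding r by (metis nat_neq_iff not_less_iff_gr_or_eq order_less_trans subsetD)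
  qed
  \<comment> \<open>The rim edges are \<open>a b\<close> and \<open>c d\<close>, listed once up to
    symmetry: \<open>a\<close> is the least rim vertex and \<open>c < d\<close>.\<close>
  have F: "\<forall>x\<in>S. \<forall>a\<in>S. x \<noteq> a \<longrightarrow> (\<forall>b\<in>S. a < b \<and> b \<noteq> x \<longrightarrow>
      (\<forall>c\<in>S. a < c \<and> c \<noteq> b \<and> c \<noteq> x \<longrightarrow> (\<forall>d\<in>S. c < d \<and> d \<noteq> b \<and> d \<noteq> x \<longrightarrow>
        \<not> (r x a \<and> r x b \<and> r x c \<and> r x d \<and> r a b \<and> r c d))))"
  proof (intro ballI impI notI)
    fix x a b c d
    assume *: "a < b \<and> b \<noteq> x" "a < c \<and> c \<noteq> b \<and> c \<noteq> x" "c < d \<and> d \<noteq> b \<and> d \<noteq> x"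
      and "r x a \<and> r x b \<and> r x c \<and> r x d \<and> r a b \<and> r c d"
    then have R: "R x a" "R x b" "R x c" "R x d" "R a b" "R c d"
      unfolding r by auto
    have "has_matching R n {a, b, c, d}"
      unfolding n by (rule has_matching_2[of a b c d]) (use R * in auto)
    then show False
      using no_fan[of "{a, b, c, d}" x] R by auto
  qed
  show False
    \<comment> \<open>Blue has been eliminated, so the atoms are just the red adjacencies among the
      nine vertices.\<close>
    using T F unfolding S_def r_def
    by (simp (no_asm_use) cong: Ball_weak_cong imp_weak_cong, elim conjE, sat)
qed

end

section \<open>The path-critical Ramsey number\<close>

lemma arrows_complete_minus_path:
  assumes "n \<ge> 2"
  shows "arrows (complete_minus_path (4 * n + 1) (2 * n)) (fan_graph n) (complete_graph 3)"
proof (rule ccontr)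
  let ?F = "complete_minus_path (4 * n + 1) (2 * n)"
  assume "\<not> ?thesis"
  then obtain c where no_fan: "\<not> contains_copy (colour_class ?F c Red) (fan_graph n)"
    and no_triangle: "\<not> contains_copy (colour_class ?F c Blue) (complete_graph 3)"
    unfolding arrows_def by blast
  have verts: "verts (colour_class ?F c k) = {..<4 * n + 1}" for k
    by (simp add: colour_class_def complete_minus_path_def complete_graph_def)
  have edges: "{x, y} \<in> edges (colour_class ?F c k) \<longleftrightarrow> x < 4 * n + 1 \<and> y < 4 * n + 1 \<and> x \<noteq> y \<and>
      {x, y} \<notin> edges (path_graph (2 * n)) \<and> c {x, y} = k" for x y k
    by (auto simp: colour_class_def complete_minus_path_def complete_graph_def)
  have simple: "edges (colour_class ?F c k) \<subseteq> [verts (colour_class ?F c k)]\<^bsup>2\<^esup>" for k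
    by (auto simp: colour_class_def complete_minus_path_def complete_graph_def)
  have "fan_free_colouring n (\<lambda>x y. {x, y} \<in> edges (colour_class ?F c Red))
      (\<lambda>x y. {x, y} \<in> edges (colour_class ?F c Blue))"
  proof
    fix x y z
    show "{x, y} \<in> edges (colour_class ?F c Red) \<or> {x, y} \<in> edges (colour_class ?F c Blue) \<or>
        ((y = Suc x \<or> x = Suc y) \<and> x < 2 * n \<and> y < 2 * n)"
      if "x < 4 * n + 1" "y < 4 * n + 1" "x \<noteq> y"
    proof (cases "{x, y} \<in> edges (path_graph (2 * n))")
      case True
      then show ?thesis
        by (auto simp: path_graph_def doubleton_eq_iff)
    next
      case False
      then show ?thesis
        using that unfolding edges by (cases "c {x, y}") simp_all
    qed
    show "{x, z} \<notin> edges (colour_class ?F c Blue)"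
      if xy: "{x, y} \<in> edges (colour_class ?F c Blue)" and yz: "{y, z} \<in> edges (colour_class ?F c Blue)"
    proof
      assume xz: "{x, z} \<in> edges (colour_class ?F c Blue)"
      define f :: "nat \<Rightarrow> nat" where "f i = (if i = 0 then x else if i = 1 then y else z)" for i
      have three: "{..<3::nat} = {0, 1, 2}" by auto
      have ne: "x \<noteq> y" "y \<noteq> z" "x \<noteq> z"
        using xy yz xz edges by auto
      have "inj_on f {..<3}"
        unfolding three using ne by (auto simp: f_def)
      moreover have "f ` {..<3} \<subseteq> {..<4 * n + 1}"
        using xy yz edges by (auto simp: f_def)
      moreover have "f ` e \<in> edges (colour_class ?F c Blue)" if "e \<in> [{..<3}]\<^bsup>2\<^esup>" for e
      proof -
        have "e \<in> {{0, 1}, {1, 2}, {0, 2}}"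
          using that unfolding three by (auto simp: nsets_2_eq)
        then show ?thesis
          using xy yz xz by (auto simp: f_def insert_commute)
      qed
      ultimately show False
        using no_triangle unfolding contains_copy_def verts complete_graph_def fst_conv snd_conv
        by blast
    qed
    show "\<not> has_matching (\<lambda>x y. {x, y} \<in> edges (colour_class ?F c Red)) n
        {y. {x, y} \<in> edges (colour_class ?F c Red)}"
    proof
      assume m: "has_matching (\<lambda>x y. {x, y} \<in> edges (colour_class ?F c Red)) n
        {y. {x, y} \<in> edges (colour_class ?F c Red)}"
      \<comment> \<open>Here \<open>x\<close> is any natural number; a matching of positive size
        provides a neighbour, so \<open>x\<close> is a vertex.\<close>
      then obtain y where "{x, y} \<in> edges (colour_class ?F c Red)"
        using assms by (cases n) auto
      then have "x \<in> verts (colour_class ?F c Red)"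
        unfolding verts edges by simp
      then show False
        using contains_copy_fan[OF _ simple m] no_fan by blast
    qed
  qed (unfold edges, use assms in \<open>auto simp: insert_commute\<close>)
  then show False
    using fan_free_colouring.n_eq_2 fan_free_colouring.n_neq_2 by blast
qed

text \<open>The upper bound is inherited from the complete graph minus a path, a subgraph that
  already arrows.\<close>

lemma ramsey_number_fan_triangle:
  assumes "n \<ge> 2"
  shows "ramsey_number (fan_graph n) (complete_graph 3) = 4 * n + 1"
  unfolding ramsey_number_def
proof (rule Least_equality)
  show "arrows (complete_graph (4 * n + 1)) (fan_graph n) (complete_graph 3)"
    by (rule arrows_mono[OF arrows_complete_minus_path[OF assms]]) (auto simp: complete_minus_path_def)
next
  fix r
  assume "arrows (complete_graph r) (fan_graph n) (complete_graph 3)"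
  then show "4 * n + 1 \<le> r"
    using not_arrows_complete_graph[of r n] assms by (cases "r \<le> 4 * n") auto
qed

theorem theorem3:
  fixes n :: nat
  assumes "n \<ge> 2"
  shows "path_critical_ramsey_number (fan_graph n) (complete_graph 3) = 2 * n"
  unfolding path_critical_ramsey_number_def ramsey_number_fan_triangle[OF assms] Let_def
proof (rule Max_eqI)
  fix k
  assume "k \<in> {k. 1 \<le> k \<and> k \<le> 4 * n + 1 \<and>
    arrows (complete_minus_path (4 * n + 1) k) (fan_graph n) (complete_graph 3)}"
  then show "k \<le> 2 * n"
    using not_arrows_complete_minus_path[of n k] assms by (cases "2 * n < k") auto
qed (use assms arrows_complete_minus_path in auto)

end
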